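(* Let $\mathcal{A}_{\mathrm{train}}\subset\mathcal{A}$ be a training set and let $\alpha\in\mathcal{A}$ be such that $I_R(\alpha)$ is finite. Then for every $\alpha'\in\mathcal{A}_{\mathrm{train}}$, $$|I(\alpha)-I_R(\alpha)|\le|I(\alpha')-I_R(\alpha)|+\|C\|_\infty\big(2\max(K_x,K_y)+3\min(K_x,K_y)\big)\|\alpha-\alpha'\|_\infty.$$
   Context: Let $\mathcal{N}_x,\mathcal{N}_y,K_x,K_y\ge 1$ be integers, $X=\{x_1,\dots,x_{\mathcal{N}_x}\}$, $Y=\{y_1,\dots,y_{\mathcal{N}_y}\}$ finite sets, $c:X\times Y\to\mathbb{R}_+$ a cost function and $C=(C_{ij})$, $C_{ij}=c(x_i,y_j)$, the cost matrix, with $\|C\|_\infty=\max_{i,j}|C_{ij}|$. For a vector $w$, $\|w\|_\infty=\max_i|w_i|$. Let $\mu_1,\dots,\mu_{K_x}\in\mathbb{R}_+^{\mathcal{N}_x}$ and $\nu_1,\dots,\nu_{K_y}\in\mathbb{R}_+^{\mathcal{N}_y}$ be probability vectors. The parameter set is $$\mathcal{A}=\Big\{\alpha=(\alpha^x,\alpha^y)\in\mathbb{R}_+^{K_x+K_y}:\ \sum_{k=1}^{K_x}\alpha^x_k=1,\ \sum_{l=1}^{K_y}\alpha^y_l=1\Big\},$$ and $\mu(\alpha)=\sum_k\alpha^x_k\mu_k$, $\nu(\alpha)=\sum_l\alpha^y_l\nu_l$. A matrix $\Pi\in\mathbb{R}^{\mathcal{N}_x\times\mathcal{N}_y}$ is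 identified with the vector $\pi\in\mathbb{R}^{\mathcal{N}_x\mathcal{N}_y}$ obtained by stacking columns, $\pi_{i+(j-1)\mathcal{N}_x}=\Pi_{ij}$; let $\mathbf{c}$ be the vector associated with $C$. Let $A\in\mathbb{R}^{(\mathcal{N}_x+\mathcal{N}_y)\times\mathcal{N}_x\mathcal{N}_y}$ be the marginal constraint matrix: $(A\pi)_i=\sum_{j}\Pi_{ij}$ for $1\le i\le\mathcal{N}_x$ and $(A\pi)_{\mathcal{N}_x+j}=\sum_i\Pi_{ij}$ for $1\le j\le\mathcal{N}_y$. The high-fidelity problem is $$(P_\alpha):\quad I(\alpha)=\min\Big\{\langle\pi,\mathbf{c}\rangle:\ \pi\in\mathbb{R}_+^{\mathcal{N}_x\mathcal{N}_y},\ A\pi=\begin{pmatrix}\mu(\alpha)\\ \nu(\alpha)\end{pmatrix}\Big\}.$$ Reduced objects: $\alpha_1,\dots,\alpha_R\in\mathcal{A}$ are finitely many parameters, $\pi_*(\alpha_r)$ is a solution of $(P_{\alpha_r})$, $\widehat{W}=(\pi_*(\alpha_1)|\cdots|\pi_*(\alpha_R))$; $\widehat{U}\in\mathbb{R}^{\mathcal{N}_x\times N}$, $\widehat{V}\in\mathbb{R}^{\mathcal{N}_y\times M}$, $\widehat{S}=\begin{pmatrix}\widehat{U}&0\\0&\widehat{V}\end{pmatrix}$. The reduced-order optimal value is $$I_R(\alpha)=\inf\Big\{\langle p,\widehat{W}^T\mathbf{c}\rangle:\ p\in\mathbb{R}_+^R,\ \widehat{S}^TA\widehat{W}p=\widehat{S}^T\begin{pmatrix}\mu(\alpha)\\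 \nu(\alpha)\end{pmatrix}\Big\}.$$ *)

theory Defs
  imports "Jordan_Normal_Form.Matrix" "HOL-Library.Extended_Real"
begin

(* Vectors and matrices are those of Jordan_Normal_Form, so all indices start at 0. *)

definition nonneg_vecs :: "nat \<Rightarrow> real vec set" where
  "nonneg_vecs n = {v \<in> carrier_vec n. 0\<^sub>v n \<le> v}"

definition prob_vecs :: "nat \<Rightarrow> real vec set" where
  "prob_vecs n = {v \<in> nonneg_vecs n. (\<Sum>i<n. v $ i) = 1}"

(* Both norms are meant for nonempty index ranges only (Max of the empty set is unspecified). *)
definition vec_max_norm :: "real vec \<Rightarrow> real" where
  "vec_max_norm w = Max {\<bar>w $ i\<bar> | i. i < dim_vec w}"

definition mat_max_norm :: "real mat \<Rightarrow> real" where
  "mat_max_norm C = Max {\<bar>C $$ (i, j)\<bar> | i j. i < dim_row C \<and> j < dim_col C}"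

(* A parameter is one vector of length Kx + Ky: the first Kx entries are the x-weights,
   the last Ky entries the y-weights. *)
definition param_set :: "nat \<Rightarrow> nat \<Rightarrow> real vec set" where
  "param_set Kx Ky = {\<alpha> \<in> nonneg_vecs (Kx + Ky).
     (\<Sum>k<Kx. vec_first \<alpha> Kx $ k) = 1 \<and> (\<Sum>l<Ky. vec_last \<alpha> Ky $ l) = 1}"

definition mixture :: "nat \<Rightarrow> nat \<Rightarrow> (nat \<Rightarrow> real vec) \<Rightarrow> real vec \<Rightarrow> real vec" where
  "mixture n K \<mu> w = vec n (\<lambda>i. \<Sum>k<K. w $ k * \<mu> k $ i)"

definition marginals ::
  "nat \<Rightarrow> nat \<Rightarrow> nat \<Rightarrow> nat \<Rightarrow> (nat \<Rightarrow> real vec) \<Rightarrow> (nat \<Rightarrow> real vec) \<Rightarrow> real vec \<Rightarrow> real vec" where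
  "marginals Nx Ny Kx Ky \<mu> \<nu> \<alpha> =
     mixture Nx Kx \<mu> (vec_first \<alpha> Kx) @\<^sub>v mixture Ny Ky \<nu> (vec_last \<alpha> Ky)"

definition cost_mat ::
  "nat \<Rightarrow> nat \<Rightarrow> ('a \<Rightarrow> 'b \<Rightarrow> real) \<Rightarrow> (nat \<Rightarrow> 'a) \<Rightarrow> (nat \<Rightarrow> 'b) \<Rightarrow> real mat" where
  "cost_mat Nx Ny c x y = mat Nx Ny (\<lambda>(i, j). c (x i) (y j))"

(* Column stacking: with 0-based indices, entry (i, j) is placed at position i + j * dim_row P. *)
definition stack_cols :: "real mat \<Rightarrow> real vec" where
  "stack_cols P = vec (dim_row P * dim_col P) (\<lambda>k. P $$ (k mod dim_row P, k div dim_row P))"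

definition marginal_mat :: "nat \<Rightarrow> nat \<Rightarrow> real mat" where
  "marginal_mat Nx Ny = mat (Nx + Ny) (Nx * Ny)
     (\<lambda>(r, k). if r < Nx then (if k mod Nx = r then 1 else 0)
               else (if k div Nx = r - Nx then 1 else 0))"

lemma stack_index_less:
  fixes i j Nx Ny :: nat
  assumes "i < Nx" "j < Ny"
  shows "i + j * Nx < Nx * Ny"
proof -
  have "i + j * Nx < Nx + j * Nx" using assms by simp
  also have "\<dots> = Suc j * Nx" by simp
  also have "\<dots> \<le> Ny * Nx" using assms by (intro mult_le_mono1) simp
  finally show ?thesis by (simp add: mult.commute)
qed

lemma stack_cols_index:
  assumes "P \<in> carrier_mat Nx Ny" "i < Nx" "j < Ny"
  shows "stack_cols P $ (i + j * Nx) = P $$ (i, j)"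
  using assms stack_index_less[OF assms(2,3)] by (auto simp: stack_cols_def)

lemma sum_stacked:
  fixes f :: "nat \<Rightarrow> real"
  shows "(\<Sum>k<Nx * Ny. f k) = (\<Sum>j<Ny. \<Sum>i<Nx. f (i + j * Nx))"
proof (induction Ny)
  case (Suc n)
  have split: "(\<Sum>k<m + l. f k) = (\<Sum>k<m. f k) + (\<Sum>i<l. f (m + i))" for m l
    by (induction l) simp_all
  have "(\<Sum>k<Nx * Suc n. f k) = (\<Sum>k<Nx * n. f k) + (\<Sum>i<Nx. f (Nx * n + i))"
    using split[of "Nx * n" Nx] by (simp add: add.commute)
  then show ?case using Suc by (simp add: algebra_simps)
qed simp

lemma marginal_mat_row_sums:
  assumes P: "P \<in> carrier_mat Nx Ny" and i: "i < Nx"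
  shows "(marginal_mat Nx Ny *\<^sub>v stack_cols P) $ i = (\<Sum>j<Ny. P $$ (i, j))"
proof -
  have k: "i + j * Nx < Nx * Ny" if "i < Nx" "j < Ny" for i j
    using that by (rule stack_index_less)
  have "(marginal_mat Nx Ny *\<^sub>v stack_cols P) $ i
      = (\<Sum>k<Nx * Ny. marginal_mat Nx Ny $$ (i, k) * stack_cols P $ k)"
    using P i by (auto simp: marginal_mat_def stack_cols_def scalar_prod_def
        lessThan_atLeast0 intro!: sum.cong)
  also have "\<dots> = (\<Sum>b<Ny. \<Sum>a<Nx. marginal_mat Nx Ny $$ (i, a + b * Nx) * P $$ (a, b))"
    unfolding sum_stacked using P by (intro sum.cong refl) (simp add: stack_cols_index)
  also have "\<dots> = (\<Sum>b<Ny. \<Sum>a<Nx. if a = i then P $$ (a, b) else 0)"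
    using i k by (intro sum.cong refl) (auto simp: marginal_mat_def)
  also have "\<dots> = (\<Sum>j<Ny. P $$ (i, j))"
    using i by (simp add: sum.delta)
  finally show ?thesis .
qed

lemma marginal_mat_col_sums:
  assumes P: "P \<in> carrier_mat Nx Ny" and j: "j < Ny"
  shows "(marginal_mat Nx Ny *\<^sub>v stack_cols P) $ (Nx + j) = (\<Sum>i<Nx. P $$ (i, j))"
proof -
  have k: "i + j * Nx < Nx * Ny" if "i < Nx" "j < Ny" for i j
    using that by (rule stack_index_less)
  have "(marginal_mat Nx Ny *\<^sub>v stack_cols P) $ (Nx + j)
      = (\<Sum>k<Nx * Ny. marginal_mat Nx Ny $$ (Nx + j, k) * stack_cols P $ k)"
    using P j by (auto simp: marginal_mat_def stack_cols_def scalar_prod_def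
        lessThan_atLeast0 intro!: sum.cong)
  also have "\<dots> = (\<Sum>b<Ny. \<Sum>a<Nx. marginal_mat Nx Ny $$ (Nx + j, a + b * Nx) * P $$ (a, b))"
    unfolding sum_stacked using P by (intro sum.cong refl) (simp add: stack_cols_index)
  also have "\<dots> = (\<Sum>b<Ny. \<Sum>a<Nx. if b = j then P $$ (a, b) else 0)"
    using j k by (intro sum.cong refl) (auto simp: marginal_mat_def)
  also have "\<dots> = (\<Sum>i<Nx. P $$ (i, j))"
    using j by (subst sum.swap) (simp add: sum.delta)
  finally show ?thesis .
qed

definition transport_polytope :: "nat \<Rightarrow> nat \<Rightarrow> real vec \<Rightarrow> real vec set" where
  "transport_polytope Nx Ny b = {\<pi> \<in> nonneg_vecs (Nx * Ny). marginal_mat Nx Ny *\<^sub>v \<pi> = b}"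

definition transport_solution :: "real mat \<Rightarrow> real vec \<Rightarrow> real vec \<Rightarrow> bool" where
  "transport_solution C b \<pi> \<longleftrightarrow>
     is_arg_min (\<lambda>\<pi>. \<pi> \<bullet> stack_cols C) (\<lambda>\<pi>. \<pi> \<in> transport_polytope (dim_row C) (dim_col C) b) \<pi>"

(* LEAST on real: the minimum of the set of attained costs, not merely its infimum. *)
definition transport_value :: "real mat \<Rightarrow> real vec \<Rightarrow> real" where
  "transport_value C b =
     (LEAST v. \<exists>\<pi> \<in> transport_polytope (dim_row C) (dim_col C) b. v = \<pi> \<bullet> stack_cols C)"

definition block_diag :: "real mat \<Rightarrow> real mat \<Rightarrow> real mat" where
  "block_diag U V =
     four_block_mat U (0\<^sub>m (dim_row U) (dim_col V)) (0\<^sub>m (dim_row V) (dim_col U)) V"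

definition reduced_feasible :: "nat \<Rightarrow> nat \<Rightarrow> real mat \<Rightarrow> real mat \<Rightarrow> real vec \<Rightarrow> real vec set" where
  "reduced_feasible Nx Ny W S b = {p \<in> nonneg_vecs (dim_col W).
     (transpose_mat S * marginal_mat Nx Ny * W) *\<^sub>v p = transpose_mat S *\<^sub>v b}"

(* Extended-real valued: the infimum over an empty feasible set is infinity. *)
definition reduced_value :: "real mat \<Rightarrow> real mat \<Rightarrow> real mat \<Rightarrow> real vec \<Rightarrow> ereal" where
  "reduced_value C W S b =
     (INF p \<in> reduced_feasible (dim_row C) (dim_col C) W S b.
        ereal (p \<bullet> (transpose_mat W *\<^sub>v stack_cols C)))"

end

theory Submission
  imports Defs "HOL-Analysis.Function_Topology"
begin

text \<open>
  Only the Lipschitz continuity of the optimal transport value in the parameter matters; the reduced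
  value enters as an arbitrary real number. To compare the values at two pairs of marginals, shrink
  an optimal plan for the first pair entrywise until its marginals are dominated by the second pair,
  then restore the missing mass, which is at most the sum of the two \<open>l\<^sup>1\<close> distances of the
  marginals, by a product coupling of the residual marginals.
\<close>

section \<open>Attainment of minima in bounded linear programs\<close>

lemma mem_nonneg_vecs: "v \<in> nonneg_vecs n \<longleftrightarrow> v \<in> carrier_vec n \<and> (\<forall>i<n. 0 \<le> v $ i)"
  by (auto simp: nonneg_vecs_def less_eq_vec_def)

text \<open>A compactness argument: the coordinate bounds place the feasible set in a box, the
  equations cut out a closed subset of it, and the linear cost is continuous there. Feasible vectors
  are replaced by functions on the naturals, extended by zero, to use the product topology.\<close>

lemma nonneg_linear_program_attains_min:
  fixes A :: "real mat" and b c :: "real vec" and B :: "nat \<Rightarrow> real" and m n :: nat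
  defines "T \<equiv> {\<pi> \<in> nonneg_vecs n. A *\<^sub>v \<pi> = b}"
  assumes A: "A \<in> carrier_mat m n" and c: "c \<in> carrier_vec n"
    and ne: "T \<noteq> {}"
    and bound: "\<And>\<pi> k. \<pi> \<in> T \<Longrightarrow> k < n \<Longrightarrow> \<pi> $ k \<le> B k"
  shows "\<exists>\<pi>\<in>T. \<forall>\<rho>\<in>T. \<pi> \<bullet> c \<le> \<rho> \<bullet> c"
proof -
  \<comment> \<open>Coordinates from \<open>n\<close> on are pinned to 0, so every factor of the
    product over all naturals is compact and Tychonoff's theorem (\<open>compactin_PiE\<close>)
    applies.\<close>
  define box where "box = Pi\<^sub>E UNIV (\<lambda>k. if k < n then {0..B k} else {0})"
  define F where "F = {f :: nat \<Rightarrow> real. \<forall>r<m. (\<Sum>k<n. A $$ (r, k) * f k) = b $ r}"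
  \<comment> \<open>Equality of vectors includes equality of dimensions, so passing to
    coordinatewise equations requires the dimension of \<open>b\<close>; nonemptiness of
    \<open>T\<close> supplies it.\<close>
  have b: "dim_vec b = m"
    using ne A by (auto simp: T_def)
  have mult: "(A *\<^sub>v v) $ r = (\<Sum>k<n. A $$ (r, k) * v $ k)" if "v \<in> carrier_vec n" "r < m" for v r
    using that A by (auto simp: scalar_prod_def lessThan_atLeast0 intro!: sum.cong)
  have feasible: "A *\<^sub>v v = b \<longleftrightarrow> (\<lambda>k. if k < n then v $ k else 0) \<in> F" if "v \<in> carrier_vec n" for v
    using that A b mult[OF that] by (auto simp: F_def vec_eq_iff)
  have coord: "continuous_on UNIV (\<lambda>f :: nat \<Rightarrow> real. f k)" for k
    by (rule continuous_on_product_coordinates)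
  have "compactin (product_topology (\<lambda>i. euclidean) UNIV) box"
    unfolding box_def compactin_PiE by auto
  then have "compact box"
    by (simp add: euclidean_product_topology)
  moreover have "F = (\<Inter>r\<in>{..<m}. {f. (\<Sum>k<n. A $$ (r, k) * f k) = b $ r})"
    by (auto simp: F_def)
  then have "closed F"
    by (auto intro!: closed_INT closed_Collect_eq continuous_intros coord)
  ultimately have compact: "compact (box \<inter> F)"
    by (rule compact_Int_closed)
  have to_fun: "(\<lambda>k. if k < n then \<pi> $ k else 0) \<in> box \<inter> F" if "\<pi> \<in> T" for \<pi>
  proof
    show "(\<lambda>k. if k < n then \<pi> $ k else 0) \<in> box"
      using that bound[OF that] by (simp add: box_def PiE_iff T_def mem_nonneg_vecs)
    show "(\<lambda>k. if k < n then \<pi> $ k else 0) \<in> F"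
      using that feasible[of \<pi>] by (simp add: T_def nonneg_vecs_def)
  qed
  \<comment> \<open>Truncation to the first \<open>n\<close> coordinates is the way back: a
    minimizer among functions becomes a feasible vector.\<close>
  have of_fun: "vec n f \<in> T" if "f \<in> box \<inter> F" for f
  proof -
    have "f k \<in> (if k < n then {0..B k} else {0})" for k
      using that unfolding box_def by (blast dest: PiE_mem[OF _ UNIV_I])
    then have *: "0 \<le> f k" if "k < n" for k
      using that by (metis atLeastAtMost_iff)
    have "(\<lambda>k. if k < n then vec n f $ k else 0) \<in> F"
      using that by (simp add: F_def)
    then show ?thesis
      using feasible[of "vec n f"] * by (auto simp: T_def mem_nonneg_vecs)
  qed
  have "box \<inter> F \<noteq> {}"
    using ne to_fun by blast
  moreover have "continuous_on (box \<inter> F) (\<lambda>f. \<Sum>k<n. f k * c $ k)"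
    by (rule continuous_on_subset[of UNIV]) (auto intro!: continuous_intros coord)
  ultimately obtain f where f: "f \<in> box \<inter> F"
    and min: "\<And>g. g \<in> box \<inter> F \<Longrightarrow> (\<Sum>k<n. f k * c $ k) \<le> (\<Sum>k<n. g k * c $ k)"
    using continuous_attains_inf[OF compact] by blast
  have "vec n f \<bullet> c \<le> \<rho> \<bullet> c" if "\<rho> \<in> T" for \<rho>
    using min[OF to_fun[OF that]] c by (simp add: scalar_prod_def lessThan_atLeast0)
  then show ?thesis
    using of_fun[OF f] by blast
qed

section \<open>Transport plans as matrices\<close>

lemma marginal_mat_carrier: "marginal_mat Nx Ny \<in> carrier_mat (Nx + Ny) (Nx * Ny)"
  by (simp add: marginal_mat_def)

lemma unstack_index_less:
  fixes k Nx Ny :: nat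
  assumes "k < Nx * Ny"
  shows "k mod Nx < Nx" "k div Nx < Ny"
proof -
  have "0 < Nx"
    using assms by (cases Nx) auto
  then show "k mod Nx < Nx"
    by simp
  show "k div Nx < Ny"
    using assms by (simp add: less_mult_imp_div_less mult.commute)
qed

lemma stack_cols_scalar_prod:
  assumes "P \<in> carrier_mat Nx Ny" "C \<in> carrier_mat Nx Ny"
  shows "stack_cols P \<bullet> stack_cols C = (\<Sum>j<Ny. \<Sum>i<Nx. P $$ (i, j) * C $$ (i, j))"
proof -
  have "stack_cols P \<bullet> stack_cols C = (\<Sum>k<Nx * Ny. stack_cols P $ k * stack_cols C $ k)"
    using assms by (simp add: scalar_prod_def stack_cols_def lessThan_atLeast0)
  also have "\<dots> = (\<Sum>j<Ny. \<Sum>i<Nx. P $$ (i, j) * C $$ (i, j))"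
    unfolding sum_stacked using assms by (intro sum.cong refl) (simp add: stack_cols_index)
  finally show ?thesis .
qed

text \<open>Bridge from the stacked encoding to doubly indexed plans: feasibility becomes a matter
  of signs, row sums and column sums.\<close>

lemma stack_cols_mem_transport_polytope:
  assumes P: "P \<in> carrier_mat Nx Ny" and a: "a \<in> carrier_vec Nx" and b: "b \<in> carrier_vec Ny"
  shows "stack_cols P \<in> transport_polytope Nx Ny (a @\<^sub>v b) \<longleftrightarrow>
    (\<forall>i<Nx. \<forall>j<Ny. 0 \<le> P $$ (i, j)) \<and> (\<forall>i<Nx. (\<Sum>j<Ny. P $$ (i, j)) = a $ i) \<and>
    (\<forall>j<Ny. (\<Sum>i<Nx. P $$ (i, j)) = b $ j)"
proof -
  have dim: "dim_vec (stack_cols P) = Nx * Ny"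
    using P by (simp add: stack_cols_def)
  have "(\<forall>k<Nx * Ny. 0 \<le> stack_cols P $ k) \<longleftrightarrow> (\<forall>i<Nx. \<forall>j<Ny. 0 \<le> P $$ (i, j))" (is "?L \<longleftrightarrow> ?R")
  proof
    assume ?L
    show ?R
    proof (intro allI impI)
      fix i j assume "i < Nx" "j < Ny"
      then show "0 \<le> P $$ (i, j)"
        using \<open>?L\<close> stack_index_less[of i Nx j Ny] stack_cols_index[OF P, of i j] by metis
    qed
  next
    assume R: ?R
    show ?L
    proof safe
      fix k assume k: "k < Nx * Ny"
      show "0 \<le> stack_cols P $ k"
        using R k P unstack_index_less[OF k] by (simp add: stack_cols_def)
    qed
  qed
  moreover have "marginal_mat Nx Ny *\<^sub>v stack_cols P = a @\<^sub>v b \<longleftrightarrow>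
      (\<forall>i<Nx. (\<Sum>j<Ny. P $$ (i, j)) = a $ i) \<and> (\<forall>j<Ny. (\<Sum>i<Nx. P $$ (i, j)) = b $ j)"
    (is "?v = _ \<longleftrightarrow> _")
  proof -
    have "?v = a @\<^sub>v b \<longleftrightarrow> (\<forall>r<Nx + Ny. ?v $ r = (a @\<^sub>v b) $ r)"
      using a b marginal_mat_carrier[of Nx Ny] by (auto simp: vec_eq_iff)
    also have "\<dots> \<longleftrightarrow> (\<forall>r<Nx. ?v $ r = (a @\<^sub>v b) $ r) \<and> (\<forall>j<Ny. ?v $ (Nx + j) = (a @\<^sub>v b) $ (Nx + j))"
    proof safe
      fix r
      assume rows: "\<forall>r<Nx. ?v $ r = (a @\<^sub>v b) $ r"
        and cols: "\<forall>j<Ny. ?v $ (Nx + j) = (a @\<^sub>v b) $ (Nx + j)" and "r < Nx + Ny"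
      show "?v $ r = (a @\<^sub>v b) $ r"
      proof (cases "r < Nx")
        case False
        then show ?thesis
          using cols[rule_format, of "r - Nx"] \<open>r < Nx + Ny\<close> by simp
      qed (use rows in simp)
    qed simp_all
    finally show ?thesis
      using a b by (simp add: marginal_mat_row_sums[OF P] marginal_mat_col_sums[OF P])
  qed
  moreover have "stack_cols P \<in> carrier_vec (Nx * Ny)"
    using dim by (rule carrier_vecI)
  ultimately show ?thesis
    unfolding transport_polytope_def mem_nonneg_vecs mem_Collect_eq by blast
qed

text \<open>Lets an arbitrary point of the polytope be treated as a matrix, so that the row and
  column sum description applies to it.\<close>

lemma stack_cols_surj:
  assumes "\<pi> \<in> carrier_vec (Nx * Ny)"
  obtains P where "P \<in> carrier_mat Nx Ny" "\<pi> = stack_cols P"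
proof
  show "mat Nx Ny (\<lambda>(i, j). \<pi> $ (i + j * Nx)) \<in> carrier_mat Nx Ny"
    by simp
  show "\<pi> = stack_cols (mat Nx Ny (\<lambda>(i, j). \<pi> $ (i + j * Nx)))"
  proof (rule eq_vecI)
    fix k assume "k < dim_vec (stack_cols (mat Nx Ny (\<lambda>(i, j). \<pi> $ (i + j * Nx))))"
    then have k: "k < Nx * Ny"
      by (simp add: stack_cols_def)
    show "\<pi> $ k = stack_cols (mat Nx Ny (\<lambda>(i, j). \<pi> $ (i + j * Nx))) $ k"
      using k unstack_index_less[OF k] by (simp add: stack_cols_def)
  qed (use assms in \<open>simp add: stack_cols_def\<close>)
qed

section \<open>Existence of optimal plans\<close>

text \<open>The independent coupling shows that the polytope is nonempty; each marginal comes out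
  right because the other one has total mass 1.\<close>

lemma product_coupling_mem_transport_polytope:
  assumes "a \<in> prob_vecs Nx" "b \<in> prob_vecs Ny"
  shows "stack_cols (mat Nx Ny (\<lambda>(i, j). a $ i * b $ j)) \<in> transport_polytope Nx Ny (a @\<^sub>v b)"
proof -
  have a: "a \<in> carrier_vec Nx" "\<forall>i<Nx. 0 \<le> a $ i" "(\<Sum>i<Nx. a $ i) = 1"
    and b: "b \<in> carrier_vec Ny" "\<forall>j<Ny. 0 \<le> b $ j" "(\<Sum>j<Ny. b $ j) = 1"
    using assms by (simp_all add: prob_vecs_def mem_nonneg_vecs)
  have "(\<Sum>j<Ny. a $ i * b $ j) = a $ i" for i
    using b by (metis mult.right_neutral sum_distrib_left)
  moreover have "(\<Sum>i<Nx. a $ i * b $ j) = b $ j" for j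
    using a by (metis mult_1 sum_distrib_right)
  ultimately show ?thesis
    using a b by (subst stack_cols_mem_transport_polytope) simp_all
qed

text \<open>An entry of a nonnegative plan is at most its row sum, that is, at most the marginal of
  its row. This is the coordinate bound needed for compactness.\<close>

lemma transport_polytope_attains_min:
  assumes C: "C \<in> carrier_mat Nx Ny" and a: "a \<in> prob_vecs Nx" and b: "b \<in> prob_vecs Ny"
  shows "\<exists>\<pi>\<in>transport_polytope Nx Ny (a @\<^sub>v b). \<forall>\<rho>\<in>transport_polytope Nx Ny (a @\<^sub>v b).
    \<pi> \<bullet> stack_cols C \<le> \<rho> \<bullet> stack_cols C"
proof -
  have ab: "a \<in> carrier_vec Nx" "b \<in> carrier_vec Ny"
    using a b by (auto simp: prob_vecs_def nonneg_vecs_def)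
  have "\<pi> $ k \<le> a $ (k mod Nx)"
    if \<pi>: "\<pi> \<in> transport_polytope Nx Ny (a @\<^sub>v b)" and k: "k < Nx * Ny" for \<pi> k
  proof -
    have "\<pi> \<in> carrier_vec (Nx * Ny)"
      using \<pi> by (simp add: transport_polytope_def nonneg_vecs_def)
    then obtain P where P: "P \<in> carrier_mat Nx Ny" "\<pi> = stack_cols P"
      by (rule stack_cols_surj)
    note ij = unstack_index_less[OF k]
    have "\<pi> $ k = P $$ (k mod Nx, k div Nx)"
      using P k by (simp add: stack_cols_def)
    also have "\<dots> \<le> (\<Sum>j<Ny. P $$ (k mod Nx, j))"
      using \<pi> ij P ab by (intro member_le_sum) (auto simp: stack_cols_mem_transport_polytope)
    also have "\<dots> = a $ (k mod Nx)"
      using \<pi> ij P ab by (auto simp: stack_cols_mem_transport_polytope)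
    finally show ?thesis .
  qed
  moreover have "stack_cols C \<in> carrier_vec (Nx * Ny)"
    using C by (intro carrier_vecI) (simp add: stack_cols_def)
  ultimately show ?thesis
    using product_coupling_mem_transport_polytope[OF a b] unfolding transport_polytope_def
    by (intro nonneg_linear_program_attains_min[OF marginal_mat_carrier, where B = "\<lambda>k. a $ (k mod Nx)"])
      blast+
qed

text \<open>\<open>LEAST\<close> on the reals is informative only when a minimum exists. Attainment
  turns \<open>transport_value\<close> into the cost of an actual plan and a lower bound for all
  others.\<close>

lemma transport_value_attained:
  assumes C: "C \<in> carrier_mat Nx Ny" and "a \<in> prob_vecs Nx" "b \<in> prob_vecs Ny"
  obtains \<pi> where "\<pi> \<in> transport_polytope Nx Ny (a @\<^sub>v b)"
    "transport_value C (a @\<^sub>v b) = \<pi> \<bullet> stack_cols C"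
    "\<And>\<rho>. \<rho> \<in> transport_polytope Nx Ny (a @\<^sub>v b) \<Longrightarrow> transport_value C (a @\<^sub>v b) \<le> \<rho> \<bullet> stack_cols C"
proof -
  obtain \<pi> where \<pi>: "\<pi> \<in> transport_polytope Nx Ny (a @\<^sub>v b)"
    and min: "\<And>\<rho>. \<rho> \<in> transport_polytope Nx Ny (a @\<^sub>v b) \<Longrightarrow> \<pi> \<bullet> stack_cols C \<le> \<rho> \<bullet> stack_cols C"
    using transport_polytope_attains_min[OF assms] by blast
  have "transport_value C (a @\<^sub>v b) = \<pi> \<bullet> stack_cols C"
    unfolding transport_value_def by (rule Least_equality) (use C \<pi> min in auto)
  then show thesis
    using that \<pi> min by simp
qed

section \<open>Stability of the transport cost under a change of marginals\<close>

text \<open>Since costs are nonnegative, shrinking \<open>P\<close> does not raise the cost; since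
  they are at most \<open>L\<close>, restoring a mass \<open>m\<close> adds at most
  \<open>L * m\<close>. It remains to bound \<open>m\<close> by the two l1 distances.\<close>

lemma coupling_perturbation:
  fixes P :: "'i \<Rightarrow> 'j \<Rightarrow> real"
  assumes fin: "finite I" "finite J"
    and P: "\<And>i j. i \<in> I \<Longrightarrow> j \<in> J \<Longrightarrow> 0 \<le> P i j"
    and row: "\<And>i. i \<in> I \<Longrightarrow> (\<Sum>j\<in>J. P i j) = a i"
    and col: "\<And>j. j \<in> J \<Longrightarrow> (\<Sum>i\<in>I. P i j) = b j"
    and a': "\<And>i. i \<in> I \<Longrightarrow> 0 \<le> a' i" and b': "\<And>j. j \<in> J \<Longrightarrow> 0 \<le> b' j"
    and mass: "sum a' I = sum a I" "sum b' J = sum a I"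
    and C: "\<And>i j. i \<in> I \<Longrightarrow> j \<in> J \<Longrightarrow> 0 \<le> C i j \<and> C i j \<le> L"
  obtains P' where "\<And>i j. i \<in> I \<Longrightarrow> j \<in> J \<Longrightarrow> 0 \<le> P' i j"
    "\<And>i. i \<in> I \<Longrightarrow> (\<Sum>j\<in>J. P' i j) = a' i"
    "\<And>j. j \<in> J \<Longrightarrow> (\<Sum>i\<in>I. P' i j) = b' j"
    "(\<Sum>j\<in>J. \<Sum>i\<in>I. P' i j * C i j)
      \<le> (\<Sum>j\<in>J. \<Sum>i\<in>I. P i j * C i j) + L * ((\<Sum>i\<in>I. \<bar>a i - a' i\<bar>) + (\<Sum>j\<in>J. \<bar>b j - b' j\<bar>))"
proof -
  \<comment> \<open>The largest factor up to 1 by which row \<open>i\<close> may be scaled to stay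
    below \<open>a' i\<close>. If \<open>a i = 0\<close>, the quotient is 0 by convention; this is
    harmless, as row \<open>i\<close> of \<open>P\<close> then vanishes. The same holds for
    \<open>v\<close> and columns.\<close>
  define u where "u i = min 1 (a' i / a i)" for i
  define v where "v j = min 1 (b' j / b j)" for j
  define Q where "Q i j = P i j * (u i * v j)" for i j
  define r where "r i = a' i - (\<Sum>j\<in>J. Q i j)" for i
  define s where "s j = b' j - (\<Sum>i\<in>I. Q i j)" for j
  define m where "m = sum r I"
  \<comment> \<open>The residual marginals \<open>r\<close> and \<open>s\<close> share the total
    mass \<open>m\<close>, so dividing their product by \<open>m\<close> gives a coupling of
    them.\<close>
  define P' where "P' i j = Q i j + r i * s j / m" for i j
  have a: "0 \<le> a i" if "i \<in> I" for i
    using P that by (auto simp flip: row intro: sum_nonneg)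
  have b: "0 \<le> b j" if "j \<in> J" for j
    using P that by (auto simp flip: col intro: sum_nonneg)
  have u: "0 \<le> u i" "u i \<le> 1" "a i * u i \<le> a' i" "a i * (1 - u i) \<le> \<bar>a i - a' i\<bar>" if "i \<in> I" for i
    using a[OF that] a'[OF that] by (auto simp: u_def min_def field_simps)
  have v: "0 \<le> v j" "v j \<le> 1" "b j * v j \<le> b' j" "b j * (1 - v j) \<le> \<bar>b j - b' j\<bar>" if "j \<in> J" for j
    using b[OF that] b'[OF that] by (auto simp: v_def min_def field_simps)
  have Q: "0 \<le> Q i j" "Q i j \<le> P i j * u i" "Q i j \<le> P i j * v j" "Q i j \<le> P i j"
    "P i j - Q i j \<le> P i j * (1 - u i) + P i j * (1 - v j)" if "i \<in> I" "j \<in> J" for i j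
  proof -
    note uv = u[OF that(1)] v[OF that(2)] P[OF that]
    have "u i * v j \<le> u i" "u i * v j \<le> v j"
      using uv by (auto intro: mult_left_le mult_left_le_one_le)
    \<comment> \<open>Expanding this product bounds the joint loss \<open>1 - u i * v j\<close> by
      the row loss plus the column loss, so the two l1 distances enter additively.\<close>
    moreover have "0 \<le> (1 - u i) * (1 - v j)"
      using uv by simp
    then have "1 - u i * v j \<le> (1 - u i) + (1 - v j)"
      by (simp add: algebra_simps)
    from mult_left_mono[OF this uv(9)]
    show "P i j - Q i j \<le> P i j * (1 - u i) + P i j * (1 - v j)"
      by (simp add: Q_def algebra_simps)
    ultimately show "0 \<le> Q i j" "Q i j \<le> P i j * u i" "Q i j \<le> P i j * v j" "Q i j \<le> P i j"
      using uv by (auto simp: Q_def intro!: mult_left_mono mult_left_le)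
  qed
  have r: "0 \<le> r i" if "i \<in> I" for i
  proof -
    have "(\<Sum>j\<in>J. Q i j) \<le> (\<Sum>j\<in>J. P i j * u i)"
      using Q that by (intro sum_mono) auto
    also have "\<dots> = a i * u i"
      using row[OF that] by (simp flip: sum_distrib_right)
    finally show ?thesis
      using u[OF that] by (simp add: r_def)
  qed
  have s: "0 \<le> s j" if "j \<in> J" for j
  proof -
    have "(\<Sum>i\<in>I. Q i j) \<le> (\<Sum>i\<in>I. P i j * v j)"
      using Q that by (intro sum_mono) auto
    also have "\<dots> = b j * v j"
      using col[OF that] by (simp flip: sum_distrib_right)
    finally show ?thesis
      using v[OF that] by (simp add: s_def)
  qed
  \<comment> \<open>Both residuals arise by removing the total mass of \<open>Q\<close> from targets
    of equal mass.\<close>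
  have m_s: "m = sum s J"
    using mass by (simp add: m_def r_def s_def sum_subtractf sum.swap[of _ I J])
  have m_nonneg: "0 \<le> m"
    unfolding m_def using r by (rule sum_nonneg)
  \<comment> \<open>As \<open>a\<close> and \<open>a'\<close> have equal mass, the mass missing from
    the target equals the mass removed from \<open>P\<close>.\<close>
  have "m = (\<Sum>i\<in>I. \<Sum>j\<in>J. P i j - Q i j)"
    using mass row by (simp add: m_def r_def sum_subtractf)
  also have "\<dots> \<le> (\<Sum>i\<in>I. \<Sum>j\<in>J. P i j * (1 - u i) + P i j * (1 - v j))"
    using Q by (intro sum_mono) auto
  also have "\<dots> = (\<Sum>i\<in>I. \<Sum>j\<in>J. P i j * (1 - u i)) + (\<Sum>j\<in>J. \<Sum>i\<in>I. P i j * (1 - v j))"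
    by (simp add: sum.distrib sum.swap[of _ J I])
  also have "\<dots> = (\<Sum>i\<in>I. a i * (1 - u i)) + (\<Sum>j\<in>J. b j * (1 - v j))"
    using row col by (simp flip: sum_distrib_right)
  also have "\<dots> \<le> (\<Sum>i\<in>I. \<bar>a i - a' i\<bar>) + (\<Sum>j\<in>J. \<bar>b j - b' j\<bar>)"
    using u v by (intro add_mono sum_mono) auto
  finally have m_le: "m \<le> (\<Sum>i\<in>I. \<bar>a i - a' i\<bar>) + (\<Sum>j\<in>J. \<bar>b j - b' j\<bar>)" .
  \<comment> \<open>For \<open>m = 0\<close> the residuals vanish, so the junk value \<open>x / 0 = 0\<close> is harmless.\<close>
  have r_zero: "r i * m / m = r i" if "i \<in> I" for i
    using that fin r sum_nonneg_eq_0_iff[of I r] by (auto simp: m_def)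
  have s_zero: "m * s j / m = s j" if "j \<in> J" for j
    using that fin s sum_nonneg_eq_0_iff[of J s] by (auto simp: m_s)
  have row': "(\<Sum>j\<in>J. P' i j) = a' i" if "i \<in> I" for i
  proof -
    have "(\<Sum>j\<in>J. P' i j) = (\<Sum>j\<in>J. Q i j) + r i * m / m"
      by (simp add: P'_def sum.distrib m_s sum_distrib_left sum_divide_distrib)
    then show ?thesis
      unfolding r_zero[OF that] by (simp add: r_def)
  qed
  have col': "(\<Sum>i\<in>I. P' i j) = b' j" if "j \<in> J" for j
  proof -
    have "(\<Sum>i\<in>I. P' i j) = (\<Sum>i\<in>I. Q i j) + m * s j / m"
      by (simp add: P'_def sum.distrib m_def sum_distrib_right sum_divide_distrib)
    then show ?thesis
      unfolding s_zero[OF that] by (simp add: s_def)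
  qed
  have pos': "0 \<le> P' i j" if "i \<in> I" "j \<in> J" for i j
    using Q r s m_nonneg that by (simp add: P'_def)
  have cost: "(\<Sum>j\<in>J. \<Sum>i\<in>I. P' i j * C i j) \<le> (\<Sum>j\<in>J. \<Sum>i\<in>I. P i j * C i j) + L * m"
  proof -
    have "P' i j * C i j \<le> P i j * C i j + r i * s j / m * L" if "i \<in> I" "j \<in> J" for i j
    proof -
      have "0 \<le> r i * s j / m"
        using r s m_nonneg that by simp
      then have "r i * s j / m * C i j \<le> r i * s j / m * L"
        using C[OF that] by (intro mult_left_mono) auto
      moreover have "Q i j * C i j \<le> P i j * C i j"
        using Q(4)[OF that] C[OF that] by (intro mult_right_mono) auto
      ultimately show ?thesis
        by (simp add: P'_def distrib_right)
    qed
    then have "(\<Sum>j\<in>J. \<Sum>i\<in>I. P' i j * C i j) \<le> (\<Sum>j\<in>J. \<Sum>i\<in>I. P i j * C i j + r i * s j / m * L)"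
      by (intro sum_mono) auto
    also have "\<dots> = (\<Sum>j\<in>J. \<Sum>i\<in>I. P i j * C i j) + (\<Sum>j\<in>J. m * s j / m * L)"
      by (simp add: sum.distrib m_def sum_distrib_right sum_divide_distrib)
    \<comment> \<open>\<open>s_zero\<close> cancels the factors \<open>m\<close>, also when
      \<open>m = 0\<close>; the remaining sum of the \<open>s j\<close> is \<open>m\<close>
      again.\<close>
    also have "(\<Sum>j\<in>J. m * s j / m * L) = L * m"
      using s_zero by (simp add: m_s sum_distrib_left mult.commute cong: sum.cong)
    finally show ?thesis .
  qed
  \<comment> \<open>Monotonicity needs \<open>0 \<le> L\<close>, which the cost bounds give only if
    some pair of indices exists. If \<open>I\<close> or \<open>J\<close> is empty, \<open>L\<close>
    may be negative, but then all masses are zero and both sides vanish.\<close>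
  have "L * m \<le> L * ((\<Sum>i\<in>I. \<bar>a i - a' i\<bar>) + (\<Sum>j\<in>J. \<bar>b j - b' j\<bar>))"
  proof (cases "I = {} \<or> J = {}")
    case True
    then have "m = 0" "sum a I = 0"
      using m_s row by (auto simp: m_def)
    moreover have "0 = sum b J"
      using True by (auto simp flip: col)
    ultimately show ?thesis
      using True mass fin a a' b b'
        sum_nonneg_eq_0_iff[of I a] sum_nonneg_eq_0_iff[of I a']
        sum_nonneg_eq_0_iff[of J b] sum_nonneg_eq_0_iff[of J b'] by auto
  next
    case False
    then have "0 \<le> L"
      using C by (meson all_not_in_conv order_trans)
    then show ?thesis
      using m_le by (rule mult_left_mono[rotated])
  qed
  then show thesis
    using that[of P'] pos' row' col' cost by auto
qed

text \<open>Perturbing an optimal plan for \<open>a\<close> and \<open>b\<close> yields a competitor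
  for \<open>a'\<close> and \<open>b'\<close>. The bound is one-sided; exchanging the two pairs
  gives the other direction.\<close>

lemma transport_value_perturbation:
  assumes C: "C \<in> carrier_mat Nx Ny"
    and C_bounds: "\<And>i j. i < Nx \<Longrightarrow> j < Ny \<Longrightarrow> 0 \<le> C $$ (i, j) \<and> C $$ (i, j) \<le> L"
    and a: "a \<in> prob_vecs Nx" and b: "b \<in> prob_vecs Ny"
    and a': "a' \<in> prob_vecs Nx" and b': "b' \<in> prob_vecs Ny"
  shows "transport_value C (a' @\<^sub>v b') \<le> transport_value C (a @\<^sub>v b)
    + L * ((\<Sum>i<Nx. \<bar>a $ i - a' $ i\<bar>) + (\<Sum>j<Ny. \<bar>b $ j - b' $ j\<bar>))"
proof -
  note prob = prob_vecs_def mem_nonneg_vecs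
  have dims: "a \<in> carrier_vec Nx" "b \<in> carrier_vec Ny" "a' \<in> carrier_vec Nx" "b' \<in> carrier_vec Ny"
    using a b a' b' by (auto simp: prob)
  obtain \<pi> where \<pi>: "\<pi> \<in> transport_polytope Nx Ny (a @\<^sub>v b)"
    "transport_value C (a @\<^sub>v b) = \<pi> \<bullet> stack_cols C"
    using transport_value_attained[OF C a b] by blast
  have "\<pi> \<in> carrier_vec (Nx * Ny)"
    using \<pi> by (simp add: transport_polytope_def nonneg_vecs_def)
  then obtain P where P: "P \<in> carrier_mat Nx Ny" "\<pi> = stack_cols P"
    by (rule stack_cols_surj)
  have plan: "\<And>i j. i < Nx \<Longrightarrow> j < Ny \<Longrightarrow> 0 \<le> P $$ (i, j)"
    "\<And>i. i < Nx \<Longrightarrow> (\<Sum>j<Ny. P $$ (i, j)) = a $ i"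
    "\<And>j. j < Ny \<Longrightarrow> (\<Sum>i<Nx. P $$ (i, j)) = b $ j"
    using \<pi>(1) P dims by (auto simp: stack_cols_mem_transport_polytope)
  obtain P' where P': "\<And>i j. i < Nx \<Longrightarrow> j < Ny \<Longrightarrow> 0 \<le> P' i j"
    "\<And>i. i < Nx \<Longrightarrow> (\<Sum>j<Ny. P' i j) = a' $ i"
    "\<And>j. j < Ny \<Longrightarrow> (\<Sum>i<Nx. P' i j) = b' $ j"
    and cost: "(\<Sum>j<Ny. \<Sum>i<Nx. P' i j * C $$ (i, j)) \<le> (\<Sum>j<Ny. \<Sum>i<Nx. P $$ (i, j) * C $$ (i, j))
      + L * ((\<Sum>i<Nx. \<bar>a $ i - a' $ i\<bar>) + (\<Sum>j<Ny. \<bar>b $ j - b' $ j\<bar>))"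
    by (rule coupling_perturbation[where I = "{..<Nx}" and J = "{..<Ny}" and P = "\<lambda>i j. P $$ (i, j)"
          and a = "\<lambda>i. a $ i" and b = "\<lambda>j. b $ j" and a' = "\<lambda>i. a' $ i" and b' = "\<lambda>j. b' $ j"
          and C = "\<lambda>i j. C $$ (i, j)" and L = L])
      (use plan a b a' b' C_bounds in \<open>auto simp: prob\<close>)
  define M where "M = mat Nx Ny (\<lambda>(i, j). P' i j)"
  have M: "M \<in> carrier_mat Nx Ny"
    by (simp add: M_def)
  have "stack_cols M \<in> transport_polytope Nx Ny (a' @\<^sub>v b')"
    using M dims P' by (simp add: stack_cols_mem_transport_polytope) (simp add: M_def)
  then have "transport_value C (a' @\<^sub>v b') \<le> stack_cols M \<bullet> stack_cols C"
    using transport_value_attained[OF C a' b'] by blast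
  also have "\<dots> = (\<Sum>j<Ny. \<Sum>i<Nx. P' i j * C $$ (i, j))"
    unfolding stack_cols_scalar_prod[OF M C] by (simp add: M_def)
  finally show ?thesis
    using cost \<pi>(2) P stack_cols_scalar_prod[OF P(1) C] by simp
qed

section \<open>Lipschitz continuity in the mixture parameter\<close>

lemma mixture_mem_prob_vecs:
  assumes "\<forall>k<K. \<mu> k \<in> prob_vecs n" "\<forall>k<K. 0 \<le> w $ k" "(\<Sum>k<K. w $ k) = 1"
  shows "mixture n K \<mu> w \<in> prob_vecs n"
proof -
  have "(\<Sum>i<n. \<Sum>k<K. w $ k * \<mu> k $ i) = (\<Sum>k<K. w $ k * (\<Sum>i<n. \<mu> k $ i))"
    by (subst sum.swap) (simp add: sum_distrib_left)
  also have "\<dots> = 1"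
    using assms by (simp add: prob_vecs_def)
  finally show ?thesis
    using assms
    by (auto simp: prob_vecs_def mem_nonneg_vecs mixture_def intro!: sum_nonneg)
qed

text \<open>By the triangle inequality, each of the \<open>K\<close> components contributes at most
  \<open>d\<close> times its total mass, which is 1.\<close>

lemma mixture_l1_lipschitz:
  assumes \<mu>: "\<forall>k<K. \<mu> k \<in> prob_vecs n" and d: "\<And>k. k < K \<Longrightarrow> \<bar>w $ k - w' $ k\<bar> \<le> d"
  shows "(\<Sum>i<n. \<bar>mixture n K \<mu> w $ i - mixture n K \<mu> w' $ i\<bar>) \<le> real K * d"
proof -
  have "\<bar>mixture n K \<mu> w $ i - mixture n K \<mu> w' $ i\<bar> \<le> (\<Sum>k<K. d * \<mu> k $ i)" if "i < n" for i
  proof -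
    have "mixture n K \<mu> w $ i - mixture n K \<mu> w' $ i = (\<Sum>k<K. (w $ k - w' $ k) * \<mu> k $ i)"
      using that by (simp add: mixture_def sum_subtractf left_diff_distrib)
    also have "\<bar>\<dots>\<bar> \<le> (\<Sum>k<K. \<bar>(w $ k - w' $ k) * \<mu> k $ i\<bar>)"
      by (rule sum_abs)
    also have "\<dots> \<le> (\<Sum>k<K. d * \<mu> k $ i)"
      using \<mu> d that
      by (intro sum_mono)
        (auto simp: abs_mult prob_vecs_def mem_nonneg_vecs intro!: mult_right_mono)
    finally show ?thesis .
  qed
  then have "(\<Sum>i<n. \<bar>mixture n K \<mu> w $ i - mixture n K \<mu> w' $ i\<bar>) \<le> (\<Sum>i<n. \<Sum>k<K. d * \<mu> k $ i)"
    by (intro sum_mono) auto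
  also have "\<dots> = (\<Sum>k<K. d * (\<Sum>i<n. \<mu> k $ i))"
    by (subst sum.swap) (simp add: sum_distrib_left)
  also have "\<dots> = real K * d"
    using \<mu> by (simp add: prob_vecs_def)
  finally show ?thesis .
qed

lemma abs_le_vec_max_norm:
  assumes "i < dim_vec w"
  shows "\<bar>w $ i\<bar> \<le> vec_max_norm w"
  unfolding vec_max_norm_def using assms by (intro Max_ge) auto

lemma abs_le_mat_max_norm:
  assumes "i < dim_row C" "j < dim_col C"
  shows "\<bar>C $$ (i, j)\<bar> \<le> mat_max_norm C"
proof -
  have "{\<bar>C $$ (i, j)\<bar> | i j. i < dim_row C \<and> j < dim_col C}
      = (\<lambda>(i, j). \<bar>C $$ (i, j)\<bar>) ` ({..<dim_row C} \<times> {..<dim_col C})"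
    by auto
  then show ?thesis
    unfolding mat_max_norm_def using assms by (intro Max_ge) auto
qed

text \<open>The constant \<open>Kx + Ky\<close> is the sum of the l1 Lipschitz constants of the two
  mixtures; the cost perturbation bound adds no further factor beyond the norm of
  \<open>C\<close>.\<close>

lemma transport_value_marginals_lipschitz:
  assumes C: "C \<in> carrier_mat Nx Ny" "\<And>i j. i < Nx \<Longrightarrow> j < Ny \<Longrightarrow> 0 \<le> C $$ (i, j)"
    and pos: "0 < Nx" "0 < Ny"
    and \<mu>: "\<forall>k<Kx. \<mu> k \<in> prob_vecs Nx" and \<nu>: "\<forall>l<Ky. \<nu> l \<in> prob_vecs Ny"
    and \<alpha>: "\<alpha> \<in> param_set Kx Ky" and \<beta>: "\<beta> \<in> param_set Kx Ky"
  shows "\<bar>transport_value C (marginals Nx Ny Kx Ky \<mu> \<nu> \<alpha>) - transport_value C (marginals Nx Ny Kx Ky \<mu> \<nu> \<beta>)\<bar>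
    \<le> mat_max_norm C * real (Kx + Ky) * vec_max_norm (\<alpha> - \<beta>)"
proof -
  have L: "0 \<le> C $$ (i, j) \<and> C $$ (i, j) \<le> mat_max_norm C" if "i < Nx" "j < Ny" for i j
    using C that abs_le_mat_max_norm[of i C j] by fastforce
  have L0: "0 \<le> mat_max_norm C"
    using L[OF pos] by linarith
  have mix: "mixture Nx Kx \<mu> (vec_first \<gamma> Kx) \<in> prob_vecs Nx" "mixture Ny Ky \<nu> (vec_last \<gamma> Ky) \<in> prob_vecs Ny"
    if "\<gamma> \<in> param_set Kx Ky" for \<gamma>
    using that \<mu> \<nu>
    by (auto simp: param_set_def mem_nonneg_vecs vec_first_def vec_last_def
        intro!: mixture_mem_prob_vecs)
  \<comment> \<open>A generic bound \<open>d\<close> on the coordinate differences lets both orders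
    of the two parameters use the same number
    \<open>vec_max_norm (\<alpha> - \<beta>)\<close>.\<close>
  have upper: "transport_value C (marginals Nx Ny Kx Ky \<mu> \<nu> \<gamma>)
      \<le> transport_value C (marginals Nx Ny Kx Ky \<mu> \<nu> \<delta>) + mat_max_norm C * (real (Kx + Ky) * d)"
    if \<gamma>: "\<gamma> \<in> param_set Kx Ky" and \<delta>: "\<delta> \<in> param_set Kx Ky"
      and d: "\<And>k. k < Kx + Ky \<Longrightarrow> \<bar>\<delta> $ k - \<gamma> $ k\<bar> \<le> d" for \<gamma> \<delta> d
  proof -
    have dim: "dim_vec \<gamma> = Kx + Ky" "dim_vec \<delta> = Kx + Ky"
      using \<gamma> \<delta> by (auto simp: param_set_def nonneg_vecs_def)
    have "(\<Sum>i<Nx. \<bar>mixture Nx Kx \<mu> (vec_first \<delta> Kx) $ i - mixture Nx Kx \<mu> (vec_first \<gamma> Kx) $ i\<bar>)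
        + (\<Sum>j<Ny. \<bar>mixture Ny Ky \<nu> (vec_last \<delta> Ky) $ j - mixture Ny Ky \<nu> (vec_last \<gamma> Ky) $ j\<bar>)
        \<le> real Kx * d + real Ky * d"
      using \<mu> \<nu> d dim by (intro add_mono mixture_l1_lipschitz) (auto simp: vec_first_def vec_last_def)
    from mult_left_mono[OF this L0]
    show ?thesis
      using transport_value_perturbation[OF C(1) L mix[OF \<delta>] mix[OF \<gamma>]]
      by (simp add: marginals_def distrib_right)
  qed
  have dim: "dim_vec \<alpha> = Kx + Ky" "dim_vec \<beta> = Kx + Ky"
    using \<alpha> \<beta> by (auto simp: param_set_def nonneg_vecs_def)
  then have "\<bar>\<alpha> $ k - \<beta> $ k\<bar> \<le> vec_max_norm (\<alpha> - \<beta>)" if "k < Kx + Ky" for k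
    using abs_le_vec_max_norm[of k "\<alpha> - \<beta>"] that by simp
  then show ?thesis
    using upper[OF \<alpha> \<beta>, of "vec_max_norm (\<alpha> - \<beta>)"] upper[OF \<beta> \<alpha>, of "vec_max_norm (\<alpha> - \<beta>)"]
    by (fastforce simp: abs_le_iff abs_minus_commute mult.assoc)
qed

section \<open>The error bound for the reduced-order value\<close>

theorem mainTheorem3:
  fixes Nx Ny Kx Ky R N M :: nat
    and X :: "'a set" and Y :: "'b set" and x :: "nat \<Rightarrow> 'a" and y :: "nat \<Rightarrow> 'b"
    and c :: "'a \<Rightarrow> 'b \<Rightarrow> real" and C :: "real mat"
    and \<mu> \<nu> :: "nat \<Rightarrow> real vec"
    and I :: "real vec \<Rightarrow> real" and I\<^sub>R :: "real vec \<Rightarrow> ereal"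
    and \<alpha>s :: "nat \<Rightarrow> real vec" and \<pi>opt :: "real vec \<Rightarrow> real vec"
    and W U V S :: "real mat"
    and A_train :: "real vec set" and \<alpha> \<alpha>' :: "real vec"
  assumes "Nx \<ge> 1" "Ny \<ge> 1" "Kx \<ge> 1" "Ky \<ge> 1"
    and "X = x ` {..<Nx}" "Y = y ` {..<Ny}"
    and "\<forall>s\<in>X. \<forall>t\<in>Y. 0 \<le> c s t"
    and "C = cost_mat Nx Ny c x y"
    and "\<forall>k<Kx. \<mu> k \<in> prob_vecs Nx" "\<forall>l<Ky. \<nu> l \<in> prob_vecs Ny"
    and "I = (\<lambda>\<beta>. transport_value C (marginals Nx Ny Kx Ky \<mu> \<nu> \<beta>))"
    and "\<forall>r<R. \<alpha>s r \<in> param_set Kx Ky"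
    and "\<forall>r<R. transport_solution C (marginals Nx Ny Kx Ky \<mu> \<nu> (\<alpha>s r)) (\<pi>opt (\<alpha>s r))"
    and "W = mat_of_cols (Nx * Ny) (map (\<lambda>r. \<pi>opt (\<alpha>s r)) [0..<R])"
    and "U \<in> carrier_mat Nx N" "V \<in> carrier_mat Ny M"
    and "S = block_diag U V"
    and "I\<^sub>R = (\<lambda>\<beta>. reduced_value C W S (marginals Nx Ny Kx Ky \<mu> \<nu> \<beta>))"
    and "A_train \<subseteq> param_set Kx Ky"
    and "\<alpha> \<in> param_set Kx Ky" "\<bar>I\<^sub>R \<alpha>\<bar> \<noteq> \<infinity>"
    and "\<alpha>' \<in> A_train"
  shows "\<bar>I \<alpha> - real_of_ereal (I\<^sub>R \<alpha>)\<bar>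
    \<le> \<bar>I \<alpha>' - real_of_ereal (I\<^sub>R \<alpha>)\<bar>
      + mat_max_norm C * (2 * real (max Kx Ky) + 3 * real (min Kx Ky)) * vec_max_norm (\<alpha> - \<alpha>')"
proof -
  let ?D = "vec_max_norm (\<alpha> - \<alpha>')" and ?L = "mat_max_norm C"
  have C: "C \<in> carrier_mat Nx Ny" and C_nonneg: "\<And>i j. i < Nx \<Longrightarrow> j < Ny \<Longrightarrow> 0 \<le> C $$ (i, j)"
    using assms(5-8) by (auto simp: cost_mat_def)
  have \<alpha>': "\<alpha>' \<in> param_set Kx Ky"
    using assms(19,22) by blast
  have pos: "0 < Nx" "0 < Ny"
    using assms(1,2) by auto
  have "\<bar>I \<alpha> - I \<alpha>'\<bar> \<le> ?L * real (Kx + Ky) * ?D"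
    unfolding \<open>I = _\<close>
    by (rule transport_value_marginals_lipschitz[OF C C_nonneg pos assms(9,10) assms(20) \<alpha>'])
  \<comment> \<open>Here \<open>Kx + Ky\<close> is the sum of \<open>max Kx Ky\<close> and
    \<open>min Kx Ky\<close>, hence below the stated combination with coefficients 2 and 3.\<close>
  also have "\<dots> \<le> ?L * (2 * real (max Kx Ky) + 3 * real (min Kx Ky)) * ?D"
  proof (intro mult_right_mono mult_left_mono)
    \<comment> \<open>Nonempty index ranges matter for both norms: the absolute value of an entry at
      index 0 is a nonnegative lower bound for each maximum.\<close>
    show "0 \<le> ?L"
      using abs_le_mat_max_norm[of 0 C 0] C pos by fastforce
    show "0 \<le> ?D"
      using abs_le_vec_max_norm[of 0 "\<alpha> - \<alpha>'"] \<alpha>' \<open>Kx \<ge> 1\<close>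
      by (fastforce simp: param_set_def nonneg_vecs_def)
  qed auto
  \<comment> \<open>Triangle inequality through \<open>I \<alpha>'\<close>.\<close>
  finally show ?thesis
    by linarith
qed

end
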